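(* Let $G$ be the communication graph of a system with $n$ trajectories. If $G$ is a tree, then $IR(G)\ge\lceil n/2\rceil-1$.
   Context: Model. A system consists of pairwise disjoint unit circles $C_1,\dots,C_n$ in the plane (trajectories) and a communication range $r>0$. Its communication graph $G$ has vertex set $\{C_1,\dots,C_n\}$, $C_i,C_j$ adjacent iff the distance between their centres is at most $2+r$. Positions on a circle are angles (mod $2\pi$). For an edge $(i,j)$, the link position $\phi_{ij}$ is the angle of the point of $C_i$ closest to $C_j$. A schedule $F=(f,g)$ assigns each circle a starting angle $f(C_i)$ and direction $g(C_i)\in\{1,-1\}$; a robot following it on $C_i$ is at $f(C_i)+g(C_i)2\pi t$ at time $t$. $F$ is a synchronization schedule if $g(C_i)=-g(C_j)$ for adjacent circles and robots following $F$ on adjacent $C_i,C_j$ are at $\phi_{ij},\phi_{ji}$ at exactly the same times. A synchronized communication system (SCS) on $G$ consists of $n$ robots, initially one per circle, following a synchronization schedule, with the switching rule: when a robot on $C_i$ reaches $\phi_{ij}$ and $C_j$ is empty, it instantly passes to $C_j$ and follows the schedule of $C_j$; if $C_j$ has a robot, they meet and each stays on its circle. A partial SCS arises by letting some robots leave (possibly at different times); remaining robots never leave. A surviving robot $u$ starves if every time $u$ arrives at a link position $\phi_{ij}$ of its current circle $C_i$, the circle $C_j$ is empty; the system is in starvation state if all surviving robots starve. The isolation-resilience $IR(G)$ is the largest $k$ such that, whichever $k$ robots leave an SCS on $G$, the system does not fall into starvation state (it does not depend on the chosen synchronization schedule). *)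

theory Defs
  imports "HOL-Analysis.Analysis"
begin

text \<open>Trajectories: unit circles C_0,...,C_(n-1) with centres c i (in the complex plane).
  Robots are identified with the index of the circle on which they start.\<close>

definition disjoint_unit_circles :: "nat \<Rightarrow> (nat \<Rightarrow> complex) \<Rightarrow> bool" where
  "disjoint_unit_circles n c \<longleftrightarrow> (\<forall>i<n. \<forall>j<n. i \<noteq> j \<longrightarrow> dist (c i) (c j) > 2)"

text \<open>Communication graph.\<close>
definition comm_adj :: "nat \<Rightarrow> (nat \<Rightarrow> complex) \<Rightarrow> real \<Rightarrow> nat \<Rightarrow> nat \<Rightarrow> bool" where
  "comm_adj n c r i j \<longleftrightarrow> i < n \<and> j < n \<and> i \<noteq> j \<and> dist (c i) (c j) \<le> 2 + r"

text \<open>A graph on {0..<n} given by a symmetric adjacency relation is a tree: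
  connected and without cycles.\<close>
definition graph_connected :: "nat \<Rightarrow> (nat \<Rightarrow> nat \<Rightarrow> bool) \<Rightarrow> bool" where
  "graph_connected n A \<longleftrightarrow>
     (\<forall>i<n. \<forall>j<n. (i, j) \<in> {(a, b). A a b}\<^sup>*)"

definition graph_acyclic :: "nat \<Rightarrow> (nat \<Rightarrow> nat \<Rightarrow> bool) \<Rightarrow> bool" where
  "graph_acyclic n A \<longleftrightarrow>
     \<not> (\<exists>vs. length vs \<ge> 3 \<and> distinct vs \<and> set vs \<subseteq> {..<n}
            \<and> (\<forall>k. Suc k < length vs \<longrightarrow> A (vs ! k) (vs ! Suc k))
            \<and> A (last vs) (hd vs))"

definition is_tree :: "nat \<Rightarrow> (nat \<Rightarrow> nat \<Rightarrow> bool) \<Rightarrow> bool" where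
  "is_tree n A \<longleftrightarrow> graph_connected n A \<and> graph_acyclic n A"

text \<open>Link position phi_ij: angle of the point of C_i closest to C_j.\<close>
definition link_pos :: "(nat \<Rightarrow> complex) \<Rightarrow> nat \<Rightarrow> nat \<Rightarrow> real" where
  "link_pos c i j = Arg (c j - c i)"

text \<open>Equality of angles modulo 2 pi.\<close>
definition angle_eq :: "real \<Rightarrow> real \<Rightarrow> bool" where
  "angle_eq a b \<longleftrightarrow> (\<exists>m::int. a - b = 2 * pi * of_int m)"

text \<open>Position at time t of a robot following the schedule (f,g) on circle i.\<close>
definition sched_pos :: "(nat \<Rightarrow> real) \<Rightarrow> (nat \<Rightarrow> real) \<Rightarrow> nat \<Rightarrow> real \<Rightarrow> real" where
  "sched_pos f g i t = f i + g i * 2 * pi * t"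

definition at_link :: "(nat \<Rightarrow> complex) \<Rightarrow> (nat \<Rightarrow> real) \<Rightarrow> (nat \<Rightarrow> real) \<Rightarrow> nat \<Rightarrow> nat \<Rightarrow> real \<Rightarrow> bool" where
  "at_link c f g i j t \<longleftrightarrow> angle_eq (sched_pos f g i t) (link_pos c i j)"

definition sync_schedule ::
  "nat \<Rightarrow> (nat \<Rightarrow> complex) \<Rightarrow> real \<Rightarrow> (nat \<Rightarrow> real) \<Rightarrow> (nat \<Rightarrow> real) \<Rightarrow> bool" where
  "sync_schedule n c r f g \<longleftrightarrow>
     (\<forall>i<n. g i = 1 \<or> g i = -1) \<and>
     (\<forall>i j. comm_adj n c r i j \<longrightarrow>
        g i = - g j \<and> (\<forall>t. at_link c f g i j t \<longleftrightarrow> at_link c f g j i t))"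

text \<open>Configurations: robot u is on circle i (Some i) or has left (None).\<close>
type_synonym config = "nat \<Rightarrow> nat option"

definition init_config :: "nat \<Rightarrow> config" where
  "init_config n = (\<lambda>u. if u < n then Some u else None)"

text \<open>Robots of L leave at time lv u.\<close>
definition remove_leaving :: "nat set \<Rightarrow> (nat \<Rightarrow> real) \<Rightarrow> real \<Rightarrow> config \<Rightarrow> config" where
  "remove_leaving L lv t s = (\<lambda>u. if u \<in> L \<and> lv u = t then None else s u)"

text \<open>What happens at time t, given the configuration s just before t:
  leaving robots leave, then every robot that is at a link position phi_ij
  with C_j empty passes to C_j (otherwise it stays / meets the robot of C_j).\<close>
definition scs_step ::
  "nat \<Rightarrow> (nat \<Rightarrow> complex) \<Rightarrow> real \<Rightarrow> (nat \<Rightarrow> real) \<Rightarrow> (nat \<Rightarrow> real) \<Rightarrow>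
   nat set \<Rightarrow> (nat \<Rightarrow> real) \<Rightarrow> real \<Rightarrow> config \<Rightarrow> config" where
  "scs_step n c r f g L lv t s =
     (let s' = remove_leaving L lv t s;
          moves = (\<lambda>i j. comm_adj n c r i j \<and> at_link c f g i j t \<and> (\<forall>v. s' v \<noteq> Some j))
      in (\<lambda>u. case s' u of
                None \<Rightarrow> None
              | Some i \<Rightarrow> if \<exists>j. moves i j then Some (SOME j. moves i j) else Some i))"

text \<open>A run of the partial SCS: sigma t is the configuration just before the
  events of time t (sigma is left-continuous); right after time t the
  configuration is the result of the step at time t.\<close>
definition scs_run ::
  "nat \<Rightarrow> (nat \<Rightarrow> complex) \<Rightarrow> real \<Rightarrow> (nat \<Rightarrow> real) \<Rightarrow> (nat \<Rightarrow> real) \<Rightarrow>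
   nat set \<Rightarrow> (nat \<Rightarrow> real) \<Rightarrow> (real \<Rightarrow> config) \<Rightarrow> bool" where
  "scs_run n c r f g L lv \<sigma> \<longleftrightarrow>
     \<sigma> 0 = init_config n \<and>
     (\<forall>t>0. \<exists>\<epsilon>>0. \<forall>s. t - \<epsilon> < s \<and> s \<le> t \<longrightarrow> \<sigma> s = \<sigma> t) \<and>
     (\<forall>t\<ge>0. \<exists>\<epsilon>>0. \<forall>s. t < s \<and> s \<le> t + \<epsilon> \<longrightarrow>
        \<sigma> s = scs_step n c r f g L lv t (\<sigma> t))"

text \<open>Starvation state from time T on: every time a surviving robot arrives at a
  link position phi_ij of its current circle C_i, the circle C_j is empty.\<close>
definition starvation_from ::
  "nat \<Rightarrow> (nat \<Rightarrow> complex) \<Rightarrow> real \<Rightarrow> (nat \<Rightarrow> real) \<Rightarrow> (nat \<Rightarrow> real) \<Rightarrow>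
   nat set \<Rightarrow> (nat \<Rightarrow> real) \<Rightarrow> (real \<Rightarrow> config) \<Rightarrow> real \<Rightarrow> bool" where
  "starvation_from n c r f g L lv \<sigma> T \<longleftrightarrow>
     (\<forall>t\<ge>T. \<forall>u. u < n \<and> u \<notin> L \<longrightarrow>
        (\<forall>i j. \<sigma> t u = Some i \<and> comm_adj n c r i j \<and> at_link c f g i j t \<longrightarrow>
           (\<forall>v. remove_leaving L lv t (\<sigma> t) v \<noteq> Some j)))"

text \<open>Whichever k robots leave (at whatever times), the system never falls into
  starvation state.\<close>
definition resilient_for ::
  "nat \<Rightarrow> (nat \<Rightarrow> complex) \<Rightarrow> real \<Rightarrow> (nat \<Rightarrow> real) \<Rightarrow> (nat \<Rightarrow> real) \<Rightarrow> nat \<Rightarrow> bool" where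
  "resilient_for n c r f g k \<longleftrightarrow>
     (\<forall>L lv \<sigma>. L \<subseteq> {..<n} \<and> card L = k \<and> (\<forall>u\<in>L. lv u \<ge> 0) \<and>
        scs_run n c r f g L lv \<sigma> \<longrightarrow>
        \<not> (\<exists>T\<ge>0. starvation_from n c r f g L lv \<sigma> T))"

definition isolation_resilience ::
  "nat \<Rightarrow> (nat \<Rightarrow> complex) \<Rightarrow> real \<Rightarrow> (nat \<Rightarrow> real) \<Rightarrow> (nat \<Rightarrow> real) \<Rightarrow> nat" where
  "isolation_resilience n c r f g = (GREATEST k. k \<le> n \<and> resilient_for n c r f g k)"

end

theory Submission
  imports Defs "HOL-Combinatorics.Cycles"
begin

text \<open>In a starvation state every survivor switches circles at each link it reaches, so over one
  unit of time the circles of the survivors are permuted by the product of the transpositions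
  of the edges, taken in the order of their meeting times.  For a tree this product is an
  \<open>n\<close>-cycle, whatever the order.  Hence, looking just before the meeting time of a fixed edge
  \<open>{i, j}\<close>, each survivor is seen exactly once on \<open>i\<close> and exactly once on \<open>j\<close> during \<open>n\<close>
  consecutive periods, and never are both circles occupied.  So twice the number of survivors is
  at most \<open>n\<close>.\<close>

section \<open>Products of transpositions along a forest\<close>

text \<open>A walk becomes a path by cutting back whenever its next vertex was visited before. The
  list form matches that of \<open>graph_acyclic\<close>, which speaks of distinct vertex
  lists.\<close>

lemma rtrancl_distinct_path:
  assumes "(x, y) \<in> R\<^sup>*"
  obtains vs where "vs \<noteq> []" "hd vs = x" "last vs = y" "distinct vs"
    "\<And>k. Suc k < length vs \<Longrightarrow> (vs ! k, vs ! Suc k) \<in> R"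
proof -
  from assms have "\<exists>vs. vs \<noteq> [] \<and> hd vs = x \<and> last vs = y \<and> distinct vs \<and>
      (\<forall>k. Suc k < length vs \<longrightarrow> (vs ! k, vs ! Suc k) \<in> R)"
  proof (induction rule: rtrancl_induct)
    case base
    show ?case by (rule exI[of _ "[x]"]) simp
  next
    case (step y z)
    then obtain vs where vs: "vs \<noteq> []" "hd vs = x" "last vs = y" "distinct vs"
      "\<And>k. Suc k < length vs \<Longrightarrow> (vs ! k, vs ! Suc k) \<in> R" by blast
    show ?case
    proof (cases "z \<in> set vs")
      case True
      then obtain vs1 vs2 where split: "vs = vs1 @ z # vs2" by (meson split_list)
      have nth: "(vs1 @ [z]) ! k = vs ! k" if "k \<le> length vs1" for k
        using that by (auto simp: split nth_append)
      have "hd (vs1 @ [z]) = hd vs" "distinct (vs1 @ [z])"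
        using vs(4) by (simp_all add: split hd_append)
      moreover have "Suc k < length vs" if "Suc k < length (vs1 @ [z])" for k
        using that by (simp add: split)
      then have "((vs1 @ [z]) ! k, (vs1 @ [z]) ! Suc k) \<in> R"
        if "Suc k < length (vs1 @ [z])" for k
        using that nth[of k] nth[of "Suc k"] vs(5)[of k] by simp
      ultimately show ?thesis
        using vs(2) by (intro exI[of _ "vs1 @ [z]"]) simp
    next
      case False
      show ?thesis
      proof (intro exI[of _ "vs @ [z]"] conjI allI impI)
        fix k assume k: "Suc k < length (vs @ [z])"
        show "((vs @ [z]) ! k, (vs @ [z]) ! Suc k) \<in> R"
        proof (cases "Suc k < length vs")
          case False
          with k have "k = length vs - 1" "Suc k = length vs" by auto
          then show ?thesis
            using vs step(2) by (simp add: nth_append last_conv_nth)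
        qed (use vs in \<open>simp add: nth_append\<close>)
      qed (use vs False in auto)
    qed
  qed
  then show ?thesis using that by blast
qed

text \<open>The head of the list acts first, so list order can be read as time order, and appending
  a pair multiplies by its transposition on the left.\<close>

definition swaps :: "('a \<times> 'a) list \<Rightarrow> 'a \<Rightarrow> 'a" where
  "swaps = fold (\<lambda>(a, b). Transposition.transpose a b)"

lemma swaps_simps [simp]:
  "swaps [] = id"
  "swaps (es @ es') x = swaps es' (swaps es x)"
  "swaps ((a, b) # es) x = swaps es (Transposition.transpose a b x)"
  by (auto simp: swaps_def)

lemma permutation_swaps: "permutation (swaps es)"
proof (induction es rule: rev_induct)
  case Nil
  show ?case using permutation_id by simp
next
  case (snoc e es)
  obtain a b where e: "e = (a, b)" by force
  have "swaps (es @ [e]) = Transposition.transpose a b \<circ> swaps es"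
    by (auto simp: e)
  then show ?case
    using snoc permutation_compose[OF permutation_swap_id] by metis
qed

text \<open>Each point lies in at most one pair, so at most one factor moves it. This is the
  situation of the links that are met at the same instant.\<close>

lemma swaps_disjoint:
  assumes "\<And>e e'. \<lbrakk>e \<in> set es; e' \<in> set es; e \<noteq> e'\<rbrakk> \<Longrightarrow>
      {fst e, snd e} \<inter> {fst e', snd e'} = {}"
    and "distinct es"
  shows "(a, b) \<in> set es \<Longrightarrow> swaps es a = b"
    and "(a, b) \<in> set es \<Longrightarrow> swaps es b = a"
    and "(\<And>e. e \<in> set es \<Longrightarrow> x \<noteq> fst e \<and> x \<noteq> snd e) \<Longrightarrow> swaps es x = x"
proof -
  have fix_pt: "swaps es' x = x" if "\<And>e. e \<in> set es' \<Longrightarrow> x \<noteq> fst e \<and> x \<noteq> snd e"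
    for es' :: "('a \<times> 'a) list" and x
    using that
  proof (induction es')
    case (Cons e es')
    obtain a b where e: "e = (a, b)" by force
    have "x \<noteq> a" "x \<noteq> b" using Cons.prems[of e] e by auto
    then show ?case using Cons by (simp add: e)
  qed auto
  show "swaps es x = x" if "\<And>e. e \<in> set es \<Longrightarrow> x \<noteq> fst e \<and> x \<noteq> snd e"
    by (rule fix_pt) (use that in auto)
  have "swaps es a = b \<and> swaps es b = a" if ab: "(a, b) \<in> set es"
  proof -
    from ab obtain es1 es2 where es: "es = es1 @ (a, b) # es2"
      by (meson split_list)
    have "{a, b} \<inter> {fst e, snd e} = {}" if e: "e \<in> set es1 \<union> set es2" for e
    proof -
      have "e \<noteq> (a, b)" using assms(2) e by (auto simp: es)
      then show ?thesis using assms(1)[of "(a, b)" e] e by (simp add: es)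
    qed
    then have "swaps es1 a = a" "swaps es1 b = b" "swaps es2 a = a" "swaps es2 b = b"
      by (auto intro!: fix_pt)
    then show ?thesis by (simp add: es)
  qed
  then show "(a, b) \<in> set es \<Longrightarrow> swaps es a = b" "(a, b) \<in> set es \<Longrightarrow> swaps es b = a"
    by auto
qed

section \<open>Orbits of permutations and of products of transpositions\<close>

definition same_orbit :: "('a \<Rightarrow> 'a) \<Rightarrow> 'a \<Rightarrow> 'a \<Rightarrow> bool" where
  "same_orbit p x y \<longleftrightarrow> (\<exists>k. (p ^^ k) x = y)"

lemma same_orbit_refl: "same_orbit p x x"
  unfolding same_orbit_def by (rule exI[of _ 0]) simp

lemma same_orbit_step: "same_orbit p x (p x)"
  unfolding same_orbit_def by (rule exI[of _ 1]) simp

lemma same_orbit_trans: "same_orbit p x y \<Longrightarrow> same_orbit p y z \<Longrightarrow> same_orbit p x z"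
  unfolding same_orbit_def by (metis comp_apply funpow_add)

text \<open>Only forward iterates are allowed in \<open>same_orbit\<close>, but a permutation of
  finite order \<open>N\<close> undoes \<open>p ^^ k\<close> by the forward iterate
  \<open>p ^^ (N * k - k)\<close>.\<close>

lemma same_orbit_sym:
  assumes "permutation p" and "same_orbit p x y"
  shows "same_orbit p y x"
proof -
  obtain N where N: "p ^^ N = id" "N > 0"
    using permutation_is_nilpotent[OF assms(1)] by blast
  obtain k where k: "(p ^^ k) x = y" using assms(2) by (auto simp: same_orbit_def)
  have "k \<le> N * k" using N by simp
  then have "(p ^^ (N * k - k)) ((p ^^ k) x) = (p ^^ (N * k)) x"
    by (metis comp_apply funpow_add le_add_diff_inverse2)
  also have "\<dots> = x"
    by (simp add: N funpow_mult[symmetric])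
  finally show ?thesis using k by (auto simp: same_orbit_def)
qed

lemma same_orbit_mono:
  assumes "\<And>x. same_orbit q x (p x)" and "same_orbit p x y"
  shows "same_orbit q x y"
proof -
  have "same_orbit q x ((p ^^ k) x)" for k
  proof (induction k)
    case 0
    show ?case by (simp add: same_orbit_refl)
  next
    case (Suc k)
    from same_orbit_trans[OF this assms(1)] show ?case by simp
  qed
  then show ?thesis using assms(2) by (auto simp: same_orbit_def[of p])
qed

text \<open>Follow \<open>b\<close> along its \<open>p\<close>-cycle. Before the return to
  \<open>b\<close> neither \<open>a\<close> nor \<open>b\<close> is hit, so the transposition
  changes nothing; at the return it diverts the orbit from \<open>b\<close> to
  \<open>a\<close>.\<close>

lemma same_orbit_transpose_comp:
  assumes "permutation p" and "\<not> same_orbit p b a"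
  shows "same_orbit (Transposition.transpose a b \<circ> p) b a"
proof -
  let ?q = "Transposition.transpose a b \<circ> p"
  obtain N where N: "p ^^ N = id" "N > 0"
    using permutation_is_nilpotent[OF assms(1)] by blast
  define m where "m = (LEAST m. m > 0 \<and> (p ^^ m) b = b)"
  have "m > 0 \<and> (p ^^ m) b = b"
    unfolding m_def by (rule LeastI[of _ N]) (use N in auto)
  then have m: "m > 0" "(p ^^ m) b = b" by auto
  have least: "(p ^^ k) b \<noteq> b" if "0 < k" "k < m" for k
    using not_less_Least[of k "\<lambda>m. m > 0 \<and> (p ^^ m) b = b"] that unfolding m_def by auto
  have ne: "(p ^^ k) b \<noteq> a" for k
    using assms(2) by (auto simp: same_orbit_def)
  have before: "(?q ^^ k) b = (p ^^ k) b" if "k < m" for k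
    using that
  proof (induction k)
    case (Suc k)
    then show ?case
      using least[of "Suc k"] ne[of "Suc k"] by (simp add: transpose_def)
  qed auto
  obtain k where k: "m = Suc k" using m(1) gr0_conv_Suc by auto
  have "(?q ^^ m) b = Transposition.transpose a b (p ((p ^^ k) b))"
    using before[of k] k by simp
  also have "\<dots> = a"
    using m(2) k by simp
  finally show ?thesis by (auto simp: same_orbit_def)
qed

text \<open>Multiplying by a transposition of two points in different orbits merges these orbits, so
  the orbits of the partial products are the components of the partial forests.\<close>
lemma same_orbit_swaps:
  assumes "\<And>es1 a b es2. es = es1 @ (a, b) # es2 \<Longrightarrow> (b, a) \<notin> (set es1 \<union> (set es1)\<inverse>)\<^sup>*"
    and "(x, y) \<in> (set es \<union> (set es)\<inverse>)\<^sup>*"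
  shows "same_orbit (swaps es) x y"
proof -
  \<comment> \<open>Two invariants are needed together: points never leave their component, which
    makes the orbits of the next edge's ends distinct, and the ends of each earlier edge already
    share an orbit.\<close>
  have edge: "(\<forall>x. (x, swaps es x) \<in> (set es \<union> (set es)\<inverse>)\<^sup>*) \<and>
      (\<forall>(x, y) \<in> set es. same_orbit (swaps es) x y)"
    using assms(1)
  proof (induction es rule: rev_induct)
    case (snoc e es)
    obtain a b where e: "e = (a, b)" by force
    let ?p = "swaps es" and ?q = "swaps (es @ [e])"
    let ?R = "set es \<union> (set es)\<inverse>" and ?R' = "set (es @ [e]) \<union> (set (es @ [e]))\<inverse>"
    have "\<forall>es1 a b es2. es = es1 @ (a, b) # es2 \<longrightarrow> (b, a) \<notin> (set es1 \<union> (set es1)\<inverse>)\<^sup>*"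
      using snoc.prems by (metis append.assoc append_Cons)
    with snoc.IH have "(\<forall>x. (x, ?p x) \<in> ?R\<^sup>*) \<and> (\<forall>(x, y) \<in> set es. same_orbit ?p x y)"
      by blast
    then have IH: "(x, ?p x) \<in> ?R\<^sup>*" "(x, y) \<in> set es \<Longrightarrow> same_orbit ?p x y" for x y
      by auto
    have q: "?q = Transposition.transpose a b \<circ> ?p" by (auto simp: e)
    have mono: "?R\<^sup>* \<subseteq> ?R'\<^sup>*" by (rule rtrancl_mono) auto
    have new: "(a, b) \<in> ?R'" "(b, a) \<in> ?R'" by (auto simp: e)
    have "(x, ?q x) \<in> ?R'\<^sup>*" for x
    proof -
      have "(x, ?p x) \<in> ?R'\<^sup>*" using IH(1) mono by blast
      moreover have "(y, Transposition.transpose a b y) \<in> ?R'\<^sup>*" for y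
        using r_into_rtrancl[OF new(1)] r_into_rtrancl[OF new(2)]
        unfolding Transposition.transpose_def by (simp split: if_split del: set_append)
      ultimately show ?thesis unfolding q comp_def by (meson rtrancl_trans)
    qed
    moreover have "same_orbit ?q x y" if xy: "(x, y) \<in> set (es @ [e])" for x y
    proof -
      have "(x, (?p ^^ k) x) \<in> ?R\<^sup>*" for x k
      proof (induction k)
        case (Suc k)
        then show ?case using rtrancl_trans[OF _ IH(1)] by simp
      qed simp
      \<comment> \<open>The \<open>?p\<close>-orbit of \<open>b\<close> stays in its component, and
        the hypothesis for the last edge keeps \<open>a\<close> out of that component.\<close>
      then have "\<not> same_orbit ?p b a"
        using snoc.prems[of es a b "[]"] e unfolding same_orbit_def by auto
      then have ba: "same_orbit ?q b a"
        using same_orbit_transpose_comp[OF permutation_swaps] q by metis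
      have ab: "same_orbit ?q a b"
        by (rule same_orbit_sym[OF permutation_swaps ba])
      \<comment> \<open>Old orbits survive inside new ones: a \<open>?q\<close>-step differs from a
        \<open>?p\<close>-step only by exchanging \<open>a\<close> and \<open>b\<close>, which now
        share an orbit.\<close>
      have p_step: "same_orbit ?q x (?p x)" for x
      proof -
        have step: "same_orbit ?q x (Transposition.transpose a b (?p x))"
          using same_orbit_step[of ?q x] by (simp add: q del: swaps_simps)
        consider "?p x = a" | "?p x = b" | "?p x \<noteq> a" "?p x \<noteq> b" by blast
        then show ?thesis
        proof cases
          case 1
          with step have "same_orbit ?q x b" by (simp del: swaps_simps)
          from same_orbit_trans[OF this ba] 1 show ?thesis by (simp del: swaps_simps)
        next
          case 2
          with step have "same_orbit ?q x a" by (simp del: swaps_simps)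
          from same_orbit_trans[OF this ab] 2 show ?thesis by (simp del: swaps_simps)
        next
          case 3
          with step show ?thesis by (simp del: swaps_simps)
        qed
      qed
      show ?thesis
        using xy ab same_orbit_mono[OF p_step IH(2)] by (auto simp: e simp del: swaps_simps)
    qed
    ultimately show ?case by blast
  qed auto
  from assms(2) show ?thesis
  proof (induction rule: rtrancl_induct)
    case base
    show ?case by (rule same_orbit_refl)
  next
    case (step y z)
    have "same_orbit (swaps es) y z"
    proof (cases "(y, z) \<in> set es")
      case False
      with step(2) edge have "same_orbit (swaps es) z y" by auto
      then show ?thesis by (rule same_orbit_sym[OF permutation_swaps])
    qed (use edge in auto)
    with step(3) show ?case by (rule same_orbit_trans)
  qed
qed

text \<open>The iterates of \<open>x\<close> before its first return time \<open>m\<close> are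
  distinct and fill the orbit, which is all of \<open>{..<n}\<close>; hence
  \<open>m = n\<close>.\<close>

lemma single_orbit_funpow_bij:
  assumes "permutation p" "p ` {..<n} \<subseteq> {..<n}" "x < n"
    and "\<And>y. y < n \<Longrightarrow> same_orbit p x y"
  shows "bij_betw (\<lambda>k. (p ^^ k) x) {..<n} {..<n :: nat}"
proof -
  obtain N where N: "p ^^ N = id" "N > 0"
    using permutation_is_nilpotent[OF assms(1)] by blast
  define m where "m = (LEAST m. m > 0 \<and> (p ^^ m) x = x)"
  have "m > 0 \<and> (p ^^ m) x = x"
    unfolding m_def by (rule LeastI[of _ N]) (use N in auto)
  then have m: "m > 0" "(p ^^ m) x = x" by auto
  have least: "(p ^^ k) x \<noteq> x" if "0 < k" "k < m" for k
    using not_less_Least[of k "\<lambda>m. m > 0 \<and> (p ^^ m) x = x"] that unfolding m_def by auto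
  have inj: "inj (p ^^ k)" for k
    using assms(1) by (meson bij_betw_def inj_fn permutation_bijective)
  have no_rep: "(p ^^ k) x \<noteq> (p ^^ l) x" if "k < l" "l < m" for k l
  proof
    assume "(p ^^ k) x = (p ^^ l) x"
    also have "\<dots> = (p ^^ k) ((p ^^ (l - k)) x)"
      using that by (metis comp_apply funpow_add le_add_diff_inverse less_imp_le)
    finally have "(p ^^ (l - k)) x = x"
      using inj by (metis injD)
    then show False using least[of "l - k"] that by simp
  qed
  have inj_on: "inj_on (\<lambda>k. (p ^^ k) x) {..<m}"
    by (rule inj_onI) (metis lessThan_iff linorder_neqE_nat no_rep)
  have "(p ^^ k) x < n" for k
    by (induction k) (use assms(2,3) in auto)
  moreover have "y \<in> (\<lambda>k. (p ^^ k) x) ` {..<m}" if y: "y < n" for y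
  proof -
    obtain k where k: "(p ^^ k) x = y"
      using assms(4)[OF y] by (auto simp: same_orbit_def)
    have "(p ^^ (k mod m)) x = y"
      using funpow_mod_eq[OF m(2), of k] k by simp
    then show ?thesis using m(1) by force
  qed
  ultimately have im: "(\<lambda>k. (p ^^ k) x) ` {..<m} = {..<n}" by auto
  then have "m = n" using card_image[OF inj_on] by simp
  with inj_on im show ?thesis by (simp add: bij_betw_def)
qed

section \<open>Induction along a real interval\<close>

text \<open>Runs are specified only by local conditions on either side of each instant, so
  invariants have to be carried through continuous time. The proof is bisection
  (\<open>Bolzano\<close>) for the property that \<open>Q\<close> passes from the left end of an
  interval to its right end.\<close>

lemma real_interval_induct:
  fixes a b :: real
  assumes "a \<le> b" and "Q a"
    and right: "\<And>x. a \<le> x \<Longrightarrow> x < b \<Longrightarrow> Q x \<Longrightarrow> \<exists>\<epsilon>>0. \<forall>y. x < y \<and> y \<le> x + \<epsilon> \<and> y \<le> b \<longrightarrow> Q y"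
    and left: "\<And>x. a < x \<Longrightarrow> x \<le> b \<Longrightarrow> \<exists>\<epsilon>>0. \<forall>y. x - \<epsilon> < y \<and> y < x \<and> a \<le> y \<and> Q y \<longrightarrow> Q x"
  shows "Q b"
proof -
  have "a \<le> a \<and> b \<le> b \<longrightarrow> Q a \<longrightarrow> Q b"
    using assms(1)
  proof (rule Bolzano[where P = "\<lambda>u v. a \<le> u \<and> v \<le> b \<longrightarrow> Q u \<longrightarrow> Q v"])
    fix x assume x: "a \<le> x" "x \<le> b"
    have "\<exists>e>0. \<forall>y. x - e < y \<and> y < x \<and> a \<le> y \<and> Q y \<longrightarrow> Q x"
    proof (cases "a < x")
      case False
      then show ?thesis by (intro exI[of _ 1]) auto
    qed (use left x in blast)
    then obtain e1 where e1: "e1 > 0" "\<And>y. x - e1 < y \<Longrightarrow> y < x \<Longrightarrow> a \<le> y \<Longrightarrow> Q y \<Longrightarrow> Q x"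
      by blast
    have "\<exists>e>0. Q x \<longrightarrow> (\<forall>y. x < y \<and> y \<le> x + e \<and> y \<le> b \<longrightarrow> Q y)"
    proof (cases "x < b \<and> Q x")
      case False
      then show ?thesis using x by (intro exI[of _ 1]) auto
    qed (use right x in blast)
    then obtain e2 where e2: "e2 > 0" "\<And>y. Q x \<Longrightarrow> x < y \<Longrightarrow> y \<le> x + e2 \<Longrightarrow> y \<le> b \<Longrightarrow> Q y"
      by blast
    show "\<exists>d>0. \<forall>u v. u \<le> x \<and> x \<le> v \<and> v - u < d \<longrightarrow> (a \<le> u \<and> v \<le> b \<longrightarrow> Q u \<longrightarrow> Q v)"
    proof (intro exI[of _ "min e1 e2"] conjI allI impI)
      fix u v
      assume *: "u \<le> x \<and> x \<le> v \<and> v - u < min e1 e2" "a \<le> u \<and> v \<le> b" "Q u"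
      have "Q x"
        using e1(2)[of u] * by (cases "u = x") auto
      then show "Q v"
        using e2(2)[of v] * by (cases "v = x") auto
    qed (use e1 e2 in auto)
  qed auto
  with \<open>Q a\<close> show ?thesis by simp
qed

section \<open>Trajectories on a tree\<close>

text \<open>Lets the product of the links met up to time \<open>s\<close> be split into the earlier
  ones followed by those met exactly at \<open>s\<close>.\<close>

lemma filter_le_sorted:
  fixes \<tau> :: "'a \<Rightarrow> real"
  assumes "sorted (map \<tau> es)"
  shows "filter (\<lambda>e. \<tau> e \<le> s) es = filter (\<lambda>e. \<tau> e < s) es @ filter (\<lambda>e. \<tau> e = s) es"
  using assms
proof (induction es)
  case (Cons e es)
  then have IH: "filter (\<lambda>e. \<tau> e \<le> s) es = filter (\<lambda>e. \<tau> e < s) es @ filter (\<lambda>e. \<tau> e = s) es"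
    by simp
  have ge: "\<tau> e \<le> \<tau> e'" if "e' \<in> set es" for e'
    using Cons.prems that by simp
  show ?case
  proof (cases "\<tau> e < s")
    case False
    then have "filter (\<lambda>e. \<tau> e < s) es = []"
      using ge by (fastforce simp: filter_empty_conv)
    then show ?thesis using IH False by auto
  qed (use IH in auto)
qed simp

lemma swaps_mem:
  assumes "\<And>e. e \<in> set es \<Longrightarrow> fst e \<in> A \<and> snd e \<in> A" and "x \<in> A"
  shows "swaps es x \<in> A"
  using assms
proof (induction es arbitrary: x)
  case (Cons e es)
  obtain a b where e: "e = (a, b)" by force
  have "Transposition.transpose a b x \<in> A"
    using Cons.prems(1)[of e] Cons.prems(2) by (auto simp: e Transposition.transpose_def)
  then show ?case using Cons by (simp add: e)
qed simp

locale tree_scs =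
  fixes n :: nat and c :: "nat \<Rightarrow> complex" and r :: real and f g :: "nat \<Rightarrow> real"
  assumes disjoint_circles: "disjoint_unit_circles n c"
    and tree: "is_tree n (comm_adj n c r)"
    and sync: "sync_schedule n c r f g"
begin

abbreviation adj :: "nat \<Rightarrow> nat \<Rightarrow> bool" where
  "adj \<equiv> comm_adj n c r"

abbreviation meets :: "nat \<Rightarrow> nat \<Rightarrow> real \<Rightarrow> bool" where
  "meets \<equiv> at_link c f g"

section \<open>Adjacency and the geometry of links\<close>

lemma adj_sym: "adj i j \<Longrightarrow> adj j i"
  by (auto simp: comm_adj_def dist_commute)

lemma adj_less: "adj i j \<Longrightarrow> i < n" "adj i j \<Longrightarrow> j < n"
  by (auto simp: comm_adj_def)

lemma adj_neq: "adj i j \<Longrightarrow> i \<noteq> j"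
  by (auto simp: comm_adj_def)

lemma meets_sym: "adj i j \<Longrightarrow> meets i j t \<longleftrightarrow> meets j i t"
  using sync by (auto simp: sync_schedule_def)

lemma no_triangle:
  assumes "adj i j" "adj j k" "adj k i"
  shows False
proof -
  have "\<forall>l. Suc l < length [i, j, k] \<longrightarrow> adj ([i, j, k] ! l) ([i, j, k] ! Suc l)"
    using assms by (auto simp: less_Suc_eq numeral_eq_Suc nth_Cons split: nat.splits)
  then have "\<exists>vs. length vs \<ge> 3 \<and> distinct vs \<and> set vs \<subseteq> {..<n} \<and>
      (\<forall>l. Suc l < length vs \<longrightarrow> adj (vs ! l) (vs ! Suc l)) \<and> adj (last vs) (hd vs)"
    using assms adj_less adj_neq by (intro exI[of _ "[i, j, k]"]) (auto dest: adj_neq)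
  then show False
    using tree by (simp add: is_tree_def graph_acyclic_def)
qed

text \<open>If two neighbours lie in the same direction from a circle, then they are within
  range of each other and close a triangle.\<close>
lemma link_unique:
  assumes "adj i j" "adj i k" "meets i j t" "meets i k t"
  shows "j = k"
proof (rule ccontr)
  assume "j \<noteq> k"
  define u where "u = c j - c i"
  define v where "v = c k - c i"
  obtain m1 m2 :: int where "sched_pos f g i t - Arg u = 2 * pi * m1"
    "sched_pos f g i t - Arg v = 2 * pi * m2"
    using assms(3,4) unfolding at_link_def angle_eq_def link_pos_def u_def v_def by blast
  \<comment> \<open>Principal arguments differ by less than a full turn, so this multiple must be
    zero.\<close>
  then have "Arg v - Arg u = 2 * pi * of_int (m1 - m2)"
    by (simp add: algebra_simps)
  moreover have "\<bar>Arg v - Arg u\<bar> < 2 * pi"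
    using Arg_bounded[of u] Arg_bounded[of v] by auto
  ultimately have "\<bar>2 * pi * real_of_int (m1 - m2)\<bar> < 2 * pi * 1" by simp
  then have "\<bar>real_of_int (m1 - m2)\<bar> < 1"
    by (simp only: abs_mult) (simp add: mult_less_cancel_left_pos)
  then have "m1 = m2" by linarith
  with \<open>Arg v - Arg u = 2 * pi * of_int (m1 - m2)\<close> have Arg: "Arg v = Arg u" by simp
  have bounds: "norm u \<le> 2 + r" "norm v \<le> 2 + r" "norm u > 2" "norm v > 2"
    using assms(1,2) disjoint_circles
    by (auto simp: comm_adj_def u_def v_def dist_norm norm_minus_commute disjoint_unit_circles_def)
  \<comment> \<open>Both centres lie on one ray from \<open>c i\<close>, so their distance is the
    difference of the two radii, each between 2 and \<open>2 + r\<close>.\<close>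
  have "u = complex_of_real (norm u) * cis (Arg u)" "v = complex_of_real (norm v) * cis (Arg u)"
    using rcis_cmod_Arg[of u] rcis_cmod_Arg[of v] Arg by (simp_all add: rcis_def)
  then have "u - v = complex_of_real (norm u - norm v) * cis (Arg u)"
    by (simp add: algebra_simps)
  then have "norm (u - v) = \<bar>norm u - norm v\<bar>"
    by (simp add: norm_mult del: of_real_diff)
  also have "\<dots> \<le> 2 + r" using bounds by linarith
  finally have "adj j k"
    using assms(1,2) \<open>j \<noteq> k\<close> by (simp add: comm_adj_def u_def v_def dist_norm)
  then show False
    using no_triangle assms(1,2) adj_sym by blast
qed

text \<open>The time at which \<open>sched_pos\<close> equals the link position; multiplying by
  \<open>g i\<close> replaces dividing by it, since \<open>g i\<close> is 1 or -1.\<close>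

definition link_phase :: "nat \<times> nat \<Rightarrow> real" where
  "link_phase = (\<lambda>(i, j). g i * (link_pos c i j - f i) / (2 * pi))"

lemma meets_iff:
  assumes "adj i j"
  shows "meets i j t \<longleftrightarrow> t - link_phase (i, j) \<in> \<int>"
proof -
  have "g i = 1 \<or> g i = -1"
    using sync adj_less(1)[OF assms] by (auto simp: sync_schedule_def)
  then have g: "g i * g i = 1" by auto
  then have "g i \<noteq> 0" by auto
  have "sched_pos f g i t - link_pos c i j = 2 * pi * (g i * (t - link_phase (i, j)))"
    using g by (simp add: sched_pos_def link_phase_def field_simps)
  then have "meets i j t \<longleftrightarrow> (\<exists>m::int. g i * (t - link_phase (i, j)) = of_int m)"
    by (simp add: at_link_def angle_eq_def)
  also have "\<dots> \<longleftrightarrow> g i * (t - link_phase (i, j)) \<in> \<int>"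
    by (auto simp: Ints_def)
  also have "\<dots> \<longleftrightarrow> t - link_phase (i, j) \<in> \<int>"
    using \<open>g i = 1 \<or> g i = -1\<close> by (auto simp del: minus_diff_eq)
  finally show ?thesis .
qed

text \<open>Each undirected edge is listed once, by its increasing pair, so that it contributes a
  single transposition.\<close>

definition edges :: "(nat \<times> nat) set" where
  "edges = {(i, j). i < j \<and> adj i j}"

lemma finite_edges: "finite edges"
  by (rule finite_subset[of _ "{..<n} \<times> {..<n}"]) (auto simp: edges_def comm_adj_def)

lemma edges_adj: "edges \<union> edges\<inverse> = {(a, b). adj a b}"
  using adj_sym adj_neq by (auto simp: edges_def neq_iff)

lemma edges_connected: "x < n \<Longrightarrow> y < n \<Longrightarrow> (x, y) \<in> (edges \<union> edges\<inverse>)\<^sup>*"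
  using tree unfolding edges_adj by (auto simp: is_tree_def graph_connected_def)

text \<open>A path from \<open>b\<close> to \<open>a\<close> inside \<open>E\<close> would be closed
  to a cycle by the edge \<open>(a, b)\<close>.\<close>

lemma edges_forest:
  assumes "E \<subseteq> edges" "(a, b) \<in> edges" "(a, b) \<notin> E"
  shows "(b, a) \<notin> (E \<union> E\<inverse>)\<^sup>*"
proof
  assume "(b, a) \<in> (E \<union> E\<inverse>)\<^sup>*"
  then obtain vs where vs: "vs \<noteq> []" "hd vs = b" "last vs = a" "distinct vs"
    and step: "\<And>k. Suc k < length vs \<Longrightarrow> (vs ! k, vs ! Suc k) \<in> E \<union> E\<inverse>"
    by (rule rtrancl_distinct_path) blast
  have "E \<union> E\<inverse> \<subseteq> edges \<union> edges\<inverse>" using assms(1) by auto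
  then have step_adj: "adj (vs ! k) (vs ! Suc k)" if "Suc k < length vs" for k
    using step[OF that] edges_adj by blast
  have ab: "a < b" "adj a b" using assms(2) by (auto simp: edges_def)
  have hd: "vs ! 0 = b" and last: "vs ! (length vs - 1) = a"
    using vs by (simp_all add: hd_conv_nth last_conv_nth)
  have "length vs \<noteq> 1" using hd last ab by auto
  \<comment> \<open>A path with two vertices would be the edge itself; \<open>E\<close> contains
    neither \<open>(a, b)\<close>, by assumption, nor \<open>(b, a)\<close>, because pairs in
    \<open>edges\<close> are increasing.\<close>
  moreover have "length vs \<noteq> 2"
  proof
    assume len: "length vs = 2"
    then have "(b, a) \<in> E \<union> E\<inverse>" using step[of 0] hd last by simp
    then show False using assms ab by (auto simp: edges_def)
  qed
  ultimately have "length vs \<ge> 3" using vs(1) by (cases "length vs") auto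
  moreover have "set vs \<subseteq> {..<n}"
  proof
    fix v assume "v \<in> set vs"
    then obtain k where k: "k < length vs" "v = vs ! k" by (auto simp: in_set_conv_nth)
    show "v \<in> {..<n}"
    proof (cases "Suc k < length vs")
      case True
      then show ?thesis using step_adj adj_less k by blast
    next
      case False
      then have "k = length vs - 1" using k by simp
      then show ?thesis using last k adj_less ab by simp
    qed
  qed
  moreover have "adj (List.last vs) (List.hd vs)" using vs ab by simp
  ultimately show False
    using tree step_adj vs(4) unfolding is_tree_def graph_acyclic_def by blast
qed

text \<open>Where a robot on circle \<open>i\<close> goes at time \<open>t\<close> if it finds every
  neighbouring circle empty; \<open>link_unique\<close> makes the description well defined.\<close>

definition hop :: "real \<Rightarrow> nat \<Rightarrow> nat" where
  "hop t i = (if \<exists>j. adj i j \<and> meets i j t then THE j. adj i j \<and> meets i j t else i)"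

lemma hop_eq: "adj i j \<Longrightarrow> meets i j t \<Longrightarrow> hop t i = j"
  unfolding hop_def using link_unique by (auto intro!: the_equality)

lemma hop_stay: "\<nexists>j. adj i j \<and> meets i j t \<Longrightarrow> hop t i = i"
  by (auto simp: hop_def)

text \<open>By \<open>link_unique\<close> the links met at one instant form a matching, so their
  transpositions are disjoint and may be listed in any order.\<close>

lemma hop_eq_swaps:
  assumes es: "distinct es" "set es = {e \<in> edges. meets (fst e) (snd e) t}"
  shows "hop t x = swaps es x"
proof -
  have E: "adj a b \<and> adj b a \<and> a < b \<and> meets a b t \<and> meets b a t" if "(a, b) \<in> set es" for a b
    using that adj_sym meets_sym by (auto simp: es edges_def)
  have disj: "{fst e, snd e} \<inter> {fst e', snd e'} = {}"
    if ee: "e \<in> set es" "e' \<in> set es" "e \<noteq> e'" for e e'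
  proof -
    obtain a b a' b' where [simp]: "e = (a, b)" "e' = (a', b')" by force
    have "a \<noteq> a'" "b \<noteq> b'" "a \<noteq> b'" "b \<noteq> a'"
      using ee E[of a b] E[of a' b'] link_unique by (auto dest: link_unique)
    then show ?thesis by simp
  qed
  show ?thesis
  proof (cases "\<exists>e \<in> set es. x = fst e \<or> x = snd e")
    case True
    then obtain a b where ab: "(a, b) \<in> set es" "x = a \<or> x = b" by auto
    then show ?thesis
      using E[OF ab(1)] swaps_disjoint(1,2)[OF disj es(1) ab(1)] hop_eq by auto
  next
    case False
    have "\<nexists>j. adj x j \<and> meets x j t"
    proof
      assume "\<exists>j. adj x j \<and> meets x j t"
      then obtain j where j: "adj x j" "meets x j t" by blast
      then have "(x, j) \<in> set es \<or> (j, x) \<in> set es"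
        using adj_sym[OF j(1)] meets_sym[OF j(1)] adj_neq[OF j(1)]
        by (auto simp: es edges_def)
      with False show False by force
    qed
    moreover have "swaps es x = x"
      using False by (intro swaps_disjoint(3)[OF disj es(1)]) auto
    ultimately show ?thesis using hop_stay by simp
  qed
qed

text \<open>Starting at \<open>B\<close>, each edge \<open>e\<close> is met exactly once in the next
  unit of time, at \<open>B + \<tau> e\<close>, so a robot that always hops undergoes the
  transpositions in the order of \<open>\<tau>\<close>.\<close>

lemma hop_period:
  fixes \<rho> :: "real \<Rightarrow> nat" and \<tau> :: "nat \<times> nat \<Rightarrow> real"
  assumes es: "distinct es" "set es = edges" "sorted (map \<tau> es)"
    and \<tau>: "\<And>e. 0 \<le> \<tau> e" "\<And>e. \<tau> e < 1"
    and meets: "\<And>e s. e \<in> edges \<Longrightarrow> 0 \<le> s \<Longrightarrow> s < 1 \<Longrightarrow>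
      meets (fst e) (snd e) (B + s) \<longleftrightarrow> \<tau> e = s"
    and left: "\<And>t. t > B \<Longrightarrow> \<exists>\<epsilon>>0. \<forall>s. t - \<epsilon> < s \<and> s \<le> t \<longrightarrow> \<rho> s = \<rho> t"
    and right: "\<And>t. t \<ge> B \<Longrightarrow> \<exists>\<epsilon>>0. \<forall>s. t < s \<and> s \<le> t + \<epsilon> \<longrightarrow> \<rho> s = hop t (\<rho> t)"
  shows "\<rho> (B + 1) = swaps es (\<rho> B)"
proof -
  \<comment> \<open>The inequality is strict because \<open>\<rho>\<close> is left-continuous: its
    value at an instant precedes the hops of that instant.\<close>
  define Q where "Q s \<longleftrightarrow> \<rho> (B + s) = swaps (filter (\<lambda>e. \<tau> e < s) es) (\<rho> B)" for s
  \<comment> \<open>There are finitely many phases, so near \<open>s\<close> no phase other than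
    \<open>s\<close> itself occurs and the filtered lists are locally constant on each side.\<close>
  have avoid: "\<exists>d>0. \<forall>e \<in> set es. \<tau> e \<noteq> s \<longrightarrow> d \<le> \<bar>s - \<tau> e\<bar>" for s
    using finite_set_avoid[of "\<tau> ` set es" s] by (auto simp: dist_real_def)
  have "Q 1"
  proof (rule real_interval_induct[where a = 0 and b = 1])
    have "filter (\<lambda>e. \<tau> e < 0) es = []"
      using \<tau>(1) by (simp add: filter_empty_conv not_less)
    then show "Q 0" by (simp add: Q_def)
  next
    fix s :: real assume s: "0 \<le> s" "s < 1" "Q s"
    obtain d where d: "d > 0" "\<And>e. e \<in> set es \<Longrightarrow> \<tau> e \<noteq> s \<Longrightarrow> d \<le> \<bar>s - \<tau> e\<bar>"
      using avoid by blast
    obtain \<epsilon> where \<epsilon>: "\<epsilon> > 0"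
      "\<And>y. B + s < y \<Longrightarrow> y \<le> B + s + \<epsilon> \<Longrightarrow> \<rho> y = hop (B + s) (\<rho> (B + s))"
      using right[of "B + s"] s by auto
    have "set (filter (\<lambda>e. \<tau> e = s) es) = {e \<in> edges. meets (fst e) (snd e) (B + s)}"
      using meets s es by auto
    then have hop: "hop (B + s) x = swaps (filter (\<lambda>e. \<tau> e = s) es) x" for x
      using es(1) by (intro hop_eq_swaps) auto
    have "Q y" if y: "s < y" "y \<le> s + min \<epsilon> (d / 2)" for y
    proof -
      have "\<tau> e < y \<longleftrightarrow> \<tau> e \<le> s" if "e \<in> set es" for e
        using d(2)[OF that] y \<open>d > 0\<close> by (cases "\<tau> e = s") (auto simp: abs_if split: if_splits)
      then have "filter (\<lambda>e. \<tau> e < y) es = filter (\<lambda>e. \<tau> e \<le> s) es"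
        by (auto intro: filter_cong)
      also have "\<dots> = filter (\<lambda>e. \<tau> e < s) es @ filter (\<lambda>e. \<tau> e = s) es"
        by (rule filter_le_sorted[OF es(3)])
      finally have "swaps (filter (\<lambda>e. \<tau> e < y) es) (\<rho> B) = hop (B + s) (\<rho> (B + s))"
        using \<open>Q s\<close> by (simp add: hop Q_def)
      also have "\<dots> = \<rho> (B + y)"
        using \<epsilon>(2)[of "B + y"] y by simp
      finally show ?thesis by (simp add: Q_def)
    qed
    then show "\<exists>\<epsilon>>0. \<forall>y. s < y \<and> y \<le> s + \<epsilon> \<and> y \<le> 1 \<longrightarrow> Q y"
      using \<open>\<epsilon> > 0\<close> \<open>d > 0\<close> by (intro exI[of _ "min \<epsilon> (d / 2)"]) auto
  next
    fix s :: real assume s: "0 < s" "s \<le> 1"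
    obtain d where d: "d > 0" "\<And>e. e \<in> set es \<Longrightarrow> \<tau> e \<noteq> s \<Longrightarrow> d \<le> \<bar>s - \<tau> e\<bar>"
      using avoid by blast
    obtain \<epsilon> where \<epsilon>: "\<epsilon> > 0"
      "\<And>y. B + s - \<epsilon> < y \<Longrightarrow> y \<le> B + s \<Longrightarrow> \<rho> y = \<rho> (B + s)"
      using left[of "B + s"] s by auto
    have "Q s" if y: "s - min \<epsilon> d < y" "y < s" "Q y" for y
    proof -
      have "\<tau> e < y \<longleftrightarrow> \<tau> e < s" if "e \<in> set es" for e
        using d(2)[OF that] y \<open>d > 0\<close> by (cases "\<tau> e = s") (auto simp: abs_if split: if_splits)
      then have "filter (\<lambda>e. \<tau> e < y) es = filter (\<lambda>e. \<tau> e < s) es"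
        by (auto intro: filter_cong)
      moreover have "\<rho> (B + y) = \<rho> (B + s)"
        using \<epsilon>(2)[of "B + y"] y by simp
      ultimately show ?thesis using \<open>Q y\<close> by (simp add: Q_def)
    qed
    then show "\<exists>\<epsilon>>0. \<forall>y. s - \<epsilon> < y \<and> y < s \<and> 0 \<le> y \<and> Q y \<longrightarrow> Q s"
      using \<open>\<epsilon> > 0\<close> \<open>d > 0\<close> by (intro exI[of _ "min \<epsilon> d"]) auto
  qed auto
  moreover have "filter (\<lambda>e. \<tau> e < 1) es = es" using \<tau>(2) by simp
  ultimately show ?thesis by (simp add: Q_def)
qed

section \<open>Runs of the system\<close>

lemma scs_run_left:
  "scs_run n c r f g L lv \<sigma> \<Longrightarrow> t > 0 \<Longrightarrow> \<exists>\<epsilon>>0. \<forall>s. t - \<epsilon> < s \<and> s \<le> t \<longrightarrow> \<sigma> s = \<sigma> t"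
  unfolding scs_run_def by (drule conjunct2, drule conjunct1, drule spec, drule (1) mp)

lemma scs_run_right:
  "scs_run n c r f g L lv \<sigma> \<Longrightarrow> t \<ge> 0 \<Longrightarrow>
    \<exists>\<epsilon>>0. \<forall>s. t < s \<and> s \<le> t + \<epsilon> \<longrightarrow> \<sigma> s = scs_step n c r f g L lv t (\<sigma> t)"
  unfolding scs_run_def by (drule conjunct2, drule conjunct2, drule spec, drule (1) mp)

definition proper_config :: "nat set \<Rightarrow> config \<Rightarrow> bool" where
  "proper_config L s \<longleftrightarrow> (\<forall>u i. s u = Some i \<longrightarrow> i < n) \<and>
     (\<forall>u v i. s u = Some i \<longrightarrow> s v = Some i \<longrightarrow> u = v) \<and> (\<forall>u. u < n \<longrightarrow> u \<notin> L \<longrightarrow> s u \<noteq> None)"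

text \<open>By \<open>link_unique\<close> there is only one possible target, so the choice operator
  in \<open>scs_step\<close> must return it.\<close>

lemma scs_step_move:
  assumes "remove_leaving L lv t s u = Some i" "adj i j" "meets i j t"
    "\<And>v. remove_leaving L lv t s v \<noteq> Some j"
  shows "scs_step n c r f g L lv t s u = Some j"
proof -
  let ?P = "\<lambda>j. adj i j \<and> meets i j t \<and> (\<forall>v. remove_leaving L lv t s v \<noteq> Some j)"
  have "?P j" using assms by simp
  moreover have "(SOME j. ?P j) = j"
    using \<open>?P j\<close> link_unique by (intro some_equality) auto
  ultimately show ?thesis
    using assms(1) unfolding scs_step_def Let_def by (simp split: option.splits) blast
qed

lemma scs_step_stay:
  assumes "remove_leaving L lv t s u = Some i"
    "\<nexists>j. adj i j \<and> meets i j t \<and> (\<forall>v. remove_leaving L lv t s v \<noteq> Some j)"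
  shows "scs_step n c r f g L lv t s u = Some i"
  using assms unfolding scs_step_def Let_def by auto

lemma scs_step_None:
  "remove_leaving L lv t s u = None \<Longrightarrow> scs_step n c r f g L lv t s u = None"
  unfolding scs_step_def Let_def by auto

lemma proper_config_step:
  assumes "proper_config L s"
  shows "proper_config L (scs_step n c r f g L lv t s)"
proof -
  define s' where "s' = remove_leaving L lv t s"
  let ?q = "scs_step n c r f g L lv t s"
  have s': "proper_config L s'"
    using assms by (auto simp: proper_config_def s'_def remove_leaving_def)
  have cases: "(\<exists>i. s' u = Some i \<and> ?q u = Some i) \<or>
      (\<exists>i j. s' u = Some i \<and> ?q u = Some j \<and> adj i j \<and> meets i j t \<and> (\<forall>v. s' v \<noteq> Some j))"
    if "s' u = Some i" for u i
  proof (cases "\<exists>j. adj i j \<and> meets i j t \<and> (\<forall>v. s' v \<noteq> Some j)")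
    case True
    then obtain j where j: "adj i j" "meets i j t" "\<forall>v. s' v \<noteq> Some j" by blast
    then have "?q u = Some j"
      using that unfolding s'_def by (intro scs_step_move) auto
    then show ?thesis using that j by blast
  next
    case False
    then have "?q u = Some i"
      using that unfolding s'_def by (intro scs_step_stay) auto
    then show ?thesis using that by blast
  qed
  have none: "?q u = None" if "s' u = None" for u
    using that unfolding s'_def by (rule scs_step_None)
  have range: "i < n" if "?q u = Some i" for u i
  proof -
    have "s' u \<noteq> None" using none that by fastforce
    then show ?thesis
      using cases[of u] that s' adj_less by (fastforce simp: proper_config_def)
  qed
  \<comment> \<open>A robot enters \<open>i\<close> only if \<open>i\<close> was empty, so a
    newcomer cannot join one that stayed; two newcomers would use two links of \<open>i\<close> at
    once, against \<open>link_unique\<close>.\<close>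
  have inj: "u = v" if uv: "?q u = Some i" "?q v = Some i" for u v i
  proof -
    obtain a b where ab: "s' u = Some a" "s' v = Some b"
      using none uv by fastforce
    have u: "a = i \<or> adj a i \<and> meets a i t \<and> (\<forall>w. s' w \<noteq> Some i)"
      using cases[OF ab(1)] uv ab by auto
    have v: "b = i \<or> adj b i \<and> meets b i t \<and> (\<forall>w. s' w \<noteq> Some i)"
      using cases[OF ab(2)] uv ab by auto
    have "a = b"
      using u v ab link_unique[of i a b t] adj_sym meets_sym by auto
    then show "u = v" using ab s' by (auto simp: proper_config_def)
  qed
  have alive: "?q u \<noteq> None" if "u < n" "u \<notin> L" for u
  proof -
    obtain i where "s' u = Some i" using s' \<open>u < n\<close> \<open>u \<notin> L\<close> by (auto simp: proper_config_def)
    then show ?thesis using cases[of u i] by auto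
  qed
  show ?thesis
    unfolding proper_config_def using range inj alive by blast
qed

lemma proper_config_run:
  assumes run: "scs_run n c r f g L lv \<sigma>" and "t \<ge> 0"
  shows "proper_config L (\<sigma> t)"
proof (rule real_interval_induct[where a = 0 and b = t])
  have "\<sigma> 0 = init_config n" using run by (simp add: scs_run_def)
  then show "proper_config L (\<sigma> 0)"
    by (auto simp: proper_config_def init_config_def split: if_splits)
next
  fix x assume "0 \<le> x" "x < t" and proper: "proper_config L (\<sigma> x)"
  then obtain \<epsilon> where \<epsilon>: "\<epsilon> > 0"
    "\<And>s. x < s \<Longrightarrow> s \<le> x + \<epsilon> \<Longrightarrow> \<sigma> s = scs_step n c r f g L lv x (\<sigma> x)"
    using scs_run_right[OF run, of x] by auto
  then show "\<exists>\<epsilon>>0. \<forall>y. x < y \<and> y \<le> x + \<epsilon> \<and> y \<le> t \<longrightarrow> proper_config L (\<sigma> y)"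
    using proper_config_step[OF proper] by (intro exI[of _ \<epsilon>]) auto
next
  fix x assume "0 < x" "x \<le> t"
  then obtain \<epsilon> where \<epsilon>: "\<epsilon> > 0" "\<And>s. x - \<epsilon> < s \<Longrightarrow> s \<le> x \<Longrightarrow> \<sigma> s = \<sigma> x"
    using scs_run_left[OF run, of x] by auto
  have "proper_config L (\<sigma> x)" if "x - \<epsilon> < y" "y < x" "proper_config L (\<sigma> y)" for y
    using \<epsilon>(2)[of y] that by simp
  then show "\<exists>\<epsilon>>0. \<forall>y. x - \<epsilon> < y \<and> y < x \<and> 0 \<le> y \<and> proper_config L (\<sigma> y) \<longrightarrow>
      proper_config L (\<sigma> x)"
    using \<epsilon>(1) by (intro exI[of _ \<epsilon>]) blast
qed (use assms in auto)

section \<open>Counting the survivors of a starving system\<close>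

lemma starving_survivors:
  assumes run: "scs_run n c r f g L lv \<sigma>"
    and L: "L \<subseteq> {..<n}" and T: "T \<ge> 0" "starvation_from n c r f g L lv \<sigma> T"
    and edge: "adj i0 j0"
  shows "2 * card ({..<n} - L) \<le> n"
proof -
  define S where "S = {..<n} - L"
  obtain i j where ij: "(i, j) \<in> edges"
    using edge adj_sym adj_neq[OF edge] by (auto simp: edges_def neq_iff)
  then have adj_ij: "adj i j" by (simp add: edges_def)
  have "finite L" using L finite_subset by blast
  \<comment> \<open>After \<open>M\<close> starvation has begun and nobody leaves any more;
    inserting \<open>T\<close> also covers an empty \<open>L\<close>.\<close>
  define M where "M = Max (insert T (lv ` L))"
  have M: "T \<le> M" "\<And>u. u \<in> L \<Longrightarrow> lv u \<le> M"
    using \<open>finite L\<close> by (auto simp: M_def)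
  \<comment> \<open>A meeting time of the link between \<open>i\<close> and \<open>j\<close>; the
    added 1 puts it strictly after \<open>M\<close>.\<close>
  define B where "B = link_phase (i, j) + of_int (\<lceil>M - link_phase (i, j)\<rceil> + 1)"
  have B: "B > M" by (simp add: B_def) linarith
  have "B \<ge> 0" using B M T by simp

  \<comment> \<open>The delay from \<open>B\<close> to the first meeting on \<open>e\<close> at or
    after \<open>B\<close>.\<close>
  define \<tau> where "\<tau> e = frac (link_phase e - B)" for e
  have \<tau>: "0 \<le> \<tau> e" "\<tau> e < 1" for e
    by (auto simp: \<tau>_def frac_lt_1)
  have meets: "meets (fst e) (snd e) (B + real k + s) \<longleftrightarrow> \<tau> e = s"
    if "e \<in> edges" "0 \<le> s" "s < 1" for e s k
  proof -
    have "meets (fst e) (snd e) (B + real k + s) \<longleftrightarrow> B + real k + s - link_phase e \<in> \<int>"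
      using that meets_iff[of "fst e" "snd e"] by (auto simp: edges_def)
    also have "B + real k + s - link_phase e =
        (s - \<tau> e) + of_int (int k - \<lfloor>link_phase e - B\<rfloor>)"
      by (simp add: \<tau>_def frac_def)
    also have "\<dots> \<in> \<int> \<longleftrightarrow> s - \<tau> e \<in> \<int>"
      by (metis Ints_add Ints_diff Ints_of_int add_diff_cancel_right')
    also have "\<dots> \<longleftrightarrow> \<tau> e = s"
    proof
      assume "s - \<tau> e \<in> \<int>"
      then obtain m :: int where m: "s - \<tau> e = of_int m" by (auto elim: Ints_cases)
      then have "\<bar>real_of_int m\<bar> < 1" using \<tau>[of e] that by linarith
      then have "m = 0" by linarith
      then show "\<tau> e = s" using m by simp
    qed auto
    finally show ?thesis .
  qed
  have "\<tau> (i, j) = 0"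
    by (simp add: \<tau>_def B_def frac_eq_0_iff)
  then have meets_ij: "meets i j (B + real k)" for k
    using meets[OF ij, of 0 k] by simp

  obtain xs where xs: "set xs = edges" "distinct xs"
    using finite_distinct_list[OF finite_edges] by blast
  \<comment> \<open>Ties in \<open>\<tau>\<close> may be broken arbitrarily, since simultaneous
    links are disjoint.\<close>
  define es where "es = sort_key \<tau> xs"
  have es: "distinct es" "set es = edges" "sorted (map \<tau> es)"
    using xs by (auto simp: es_def)
  define p where "p = swaps es"

  define \<rho> where "\<rho> u t = the (\<sigma> t u)" for u t
  have \<sigma>: "\<sigma> t u = Some (\<rho> u t)" if "u \<in> S" "t \<ge> 0" for u t
    using proper_config_run[OF run that(2)] that(1)
    by (auto simp: \<rho>_def proper_config_def S_def)
  have no_leave: "remove_leaving L lv t s = s" if "t \<ge> B" for t s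
    using that B M by (force simp: remove_leaving_def fun_eq_iff)
  have starve: "\<sigma> t v \<noteq> Some b"
    if "u \<in> S" "t \<ge> B" "\<sigma> t u = Some a" "adj a b" "meets a b t" for u v t a b
  proof -
    have "t \<ge> T" using that(2) B M by simp
    then show ?thesis
      using T(2) that no_leave[OF that(2)] unfolding starvation_from_def S_def by auto
  qed

  have left: "\<exists>\<epsilon>>0. \<forall>s. t - \<epsilon> < s \<and> s \<le> t \<longrightarrow> \<rho> u s = \<rho> u t" if "t > B" for t u
  proof -
    have "t > 0" using that \<open>B \<ge> 0\<close> by simp
    from scs_run_left[OF run this] show ?thesis unfolding \<rho>_def by metis
  qed
  \<comment> \<open>Starvation empties the circle across every link a survivor reaches, so the
    switching rule reduces to \<open>hop\<close>.\<close>
  have right: "\<exists>\<epsilon>>0. \<forall>s. t < s \<and> s \<le> t + \<epsilon> \<longrightarrow> \<rho> u s = hop t (\<rho> u t)"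
    if "t \<ge> B" "u \<in> S" for t u
  proof -
    have "t \<ge> 0" using that \<open>B \<ge> 0\<close> by simp
    have pos: "remove_leaving L lv t (\<sigma> t) u = Some (\<rho> u t)"
      using no_leave[OF \<open>t \<ge> B\<close>] \<sigma>[OF \<open>u \<in> S\<close> \<open>t \<ge> 0\<close>] by simp
    have step: "scs_step n c r f g L lv t (\<sigma> t) u = Some (hop t (\<rho> u t))"
    proof (cases "\<exists>b. adj (\<rho> u t) b \<and> meets (\<rho> u t) b t")
      case True
      then obtain b where b: "adj (\<rho> u t) b" "meets (\<rho> u t) b t" by blast
      have "remove_leaving L lv t (\<sigma> t) v \<noteq> Some b" for v
        using starve[OF \<open>u \<in> S\<close> \<open>t \<ge> B\<close> \<sigma>[OF \<open>u \<in> S\<close> \<open>t \<ge> 0\<close>] b] no_leave[OF \<open>t \<ge> B\<close>] by simp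
      then show ?thesis
        using scs_step_move[OF pos b] hop_eq[OF b] by simp
    next
      case False
      then show ?thesis
        using scs_step_stay[OF pos] hop_stay[OF False] by auto
    qed
    obtain \<epsilon> where "\<epsilon> > 0"
      "\<forall>s. t < s \<and> s \<le> t + \<epsilon> \<longrightarrow> \<sigma> s = scs_step n c r f g L lv t (\<sigma> t)"
      using scs_run_right[OF run \<open>t \<ge> 0\<close>] by blast
    then show ?thesis
      using step by (intro exI[of _ \<epsilon>]) (auto simp: \<rho>_def)
  qed

  have \<rho>_Suc: "\<rho> u (B + real k + 1) = p (\<rho> u (B + real k))" if "u \<in> S" for u k
    unfolding p_def
  proof (rule hop_period[OF es \<tau> meets])
    show "\<exists>\<epsilon>>0. \<forall>s. t - \<epsilon> < s \<and> s \<le> t \<longrightarrow> \<rho> u s = \<rho> u t" if "t > B + real k" for t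
      using left[of t] that by simp
    show "\<exists>\<epsilon>>0. \<forall>s. t < s \<and> s \<le> t + \<epsilon> \<longrightarrow> \<rho> u s = hop t (\<rho> u t)" if "t \<ge> B + real k" for t
      using right[of t u] that \<open>u \<in> S\<close> by simp
  qed
  have \<rho>_funpow: "\<rho> u (B + real k) = (p ^^ k) (\<rho> u B)" if "u \<in> S" for u k
  proof (induction k)
    case (Suc k)
    have "\<rho> u (B + real (Suc k)) = \<rho> u (B + real k + 1)" by (simp add: add_ac)
    with \<rho>_Suc[OF that, of k] Suc show ?case by simp
  qed simp

  \<comment> \<open>In a forest each edge of \<open>es\<close> joins two components of the edges
    listed before it, and all edges together connect the tree.\<close>
  have "same_orbit p x y" if "x < n" "y < n" for x y
    unfolding p_def
  proof (rule same_orbit_swaps)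
    fix es1 a b es2 assume split: "es = es1 @ (a, b) # es2"
    show "(b, a) \<notin> (set es1 \<union> (set es1)\<inverse>)\<^sup>*"
      using es by (intro edges_forest) (auto simp: split)
  qed (use edges_connected that es in auto)
  moreover have "p ` {..<n} \<subseteq> {..<n}"
    using swaps_mem[of es "{..<n}"] adj_less by (fastforce simp: p_def es edges_def)
  ultimately have bij: "bij_betw (\<lambda>k. (p ^^ k) x) {..<n} {..<n}" if "x < n" for x
    using that permutation_swaps[of es] by (intro single_orbit_funpow_bij) (auto simp: p_def)
  have inj_pow: "inj (p ^^ k)" for k
    using permutation_swaps[of es] unfolding p_def
    by (meson bij_betw_def inj_fn permutation_bijective)
  have \<rho>_less: "\<rho> u B < n" if "u \<in> S" for u
    using proper_config_run[OF run \<open>B \<ge> 0\<close>] \<sigma>[OF that \<open>B \<ge> 0\<close>] by (auto simp: proper_config_def)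
  have \<rho>_inj: "u = v" if "u \<in> S" "v \<in> S" "\<rho> u B = \<rho> v B" for u v
    using proper_config_run[OF run \<open>B \<ge> 0\<close>] \<sigma>[OF _ \<open>B \<ge> 0\<close>] that
    unfolding proper_config_def by metis

  \<comment> \<open>The periods, among the first \<open>n\<close>, at whose start a survivor
    occupies \<open>w\<close>.\<close>
  define K where "K w = {k \<in> {..<n}. \<exists>u \<in> S. \<rho> u (B + real k) = w}" for w
  have card_K: "card S \<le> card (K w)" if "w < n" for w
  proof -
    have "\<exists>k<n. (p ^^ k) (\<rho> u B) = w" if "u \<in> S" for u
    proof -
      have "w \<in> (\<lambda>k. (p ^^ k) (\<rho> u B)) ` {..<n}"
        using bij[OF \<rho>_less[OF that]] \<open>w < n\<close> by (simp add: bij_betw_def)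
      then show ?thesis by auto
    qed
    then obtain \<kappa> where \<kappa>: "\<And>u. u \<in> S \<Longrightarrow> \<kappa> u < n \<and> (p ^^ \<kappa> u) (\<rho> u B) = w"
      by metis
    \<comment> \<open>Two survivors on \<open>w\<close> in the same period would have shared a
      circle at time \<open>B\<close>, as the iterates of \<open>p\<close> are injective.\<close>
    have "inj_on \<kappa> S"
      by (rule inj_onI) (metis \<kappa> \<rho>_inj inj_pow injD)
    moreover have "\<kappa> ` S \<subseteq> K w"
      using \<kappa> \<rho>_funpow by (auto simp: K_def)
    ultimately show ?thesis
      by (rule card_inj_on_le) (simp add: K_def)
  qed
  \<comment> \<open>Each period starts at a meeting time of this link, when starvation forbids both
    of its circles to be occupied.\<close>
  have "K i \<inter> K j = {}"
  proof (rule ccontr)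
    assume "K i \<inter> K j \<noteq> {}"
    then obtain k u v where k: "u \<in> S" "v \<in> S" "\<rho> u (B + real k) = i" "\<rho> v (B + real k) = j"
      by (auto simp: K_def)
    have "\<sigma> (B + real k) u = Some i" "\<sigma> (B + real k) v = Some j"
      using \<sigma>[OF k(1), of "B + real k"] \<sigma>[OF k(2), of "B + real k"] k \<open>B \<ge> 0\<close> by simp_all
    then show False
      using starve[OF k(1) _ _ adj_ij meets_ij] by simp
  qed
  then have "card (K i) + card (K j) = card (K i \<union> K j)"
    by (intro card_Un_disjoint[symmetric]) (simp_all add: K_def)
  also have "\<dots> \<le> card {..<n}"
    by (rule card_mono) (auto simp: K_def)
  finally show ?thesis
    using card_K[of i] card_K[of j] adj_less[OF adj_ij] by (simp add: S_def)
qed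

end

theorem theorem7:
  fixes n :: nat and c :: "nat \<Rightarrow> complex" and r :: real
    and f :: "nat \<Rightarrow> real" and g :: "nat \<Rightarrow> real"
  assumes "r > 0"
    and "disjoint_unit_circles n c"
    and "is_tree n (comm_adj n c r)"
    and "sync_schedule n c r f g"
  shows "nat \<lceil>real n / 2\<rceil> - 1 \<le> isolation_resilience n c r f g"
proof (cases "n \<le> 2")
  case True
  \<comment> \<open>The bound is then 0; for \<open>n = 0\<close> this is due to truncated
    subtraction.\<close>
  then have "\<lceil>real n / 2\<rceil> \<le> 1" by (simp add: ceiling_le_iff)
  then show ?thesis by simp
next
  case False
  interpret tree_scs n c r f g
    using assms(2-4) by (rule tree_scs.intro)
  define m where "m = nat \<lceil>real n / 2\<rceil> - 1"
  have m: "2 * m < n"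
    using False unfolding m_def by linarith
  \<comment> \<open>With more than one vertex, connectedness forces an edge at vertex 0, as
    \<open>starving_survivors\<close> requires.\<close>
  have "(0, 1) \<in> {(a, b). adj a b}\<^sup>*"
    using edges_connected[of 0 1] False edges_adj by simp
  then have "\<exists>j. adj 0 j"
  proof (cases rule: converse_rtranclE)
    case (step y)
    from step(1) show ?thesis by (intro exI[of _ y]) simp
  qed simp
  then obtain j0 where edge: "adj 0 j0" by (rule exE)
  have "resilient_for n c r f g m"
    unfolding resilient_for_def
  proof (intro allI impI notI, elim conjE exE)
    fix L lv \<sigma> T
    assume L: "L \<subseteq> {..<n}" "card L = m" and run: "scs_run n c r f g L lv \<sigma>"
      and T: "T \<ge> 0" "starvation_from n c r f g L lv \<sigma> T"
    \<comment> \<open>Counting gives \<open>2 * (n - m) \<le> n\<close>, which contradicts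
      \<open>2 * m < n\<close>.\<close>
    have "card ({..<n} - L) = n - m"
      using L by (simp add: card_Diff_subset finite_subset)
    then show False
      using starving_survivors[OF run L(1) T edge] m by simp
  qed
  then have "m \<le> n \<and> resilient_for n c r f g m" using m by simp
  then show ?thesis
    unfolding isolation_resilience_def m_def[symmetric]
    by (rule Greatest_le_nat[where b = n]) simp
qed

end
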